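(* Let $Q:[-1,1]\to[-1,1]$ be a smooth, odd, strictly increasing function with $Q(\pm1)=\pm1$. Let $\sigma(z)=\tanh(z/\sqrt2)$ and $W(\phi)=\tfrac14(\phi^2-1)^2$, and define $$Q_1(u)=\frac32\left(u-\frac{u^3}{3}\right),\qquad Q_1'(u)=\frac32(1-u^2).$$ Then the (unique) bounded solution $\Phi_1:\mathbb{R}\to\mathbb{R}$ of $$\Phi_1''(z)-W''(\sigma(z))\,\Phi_1(z)=\frac{\sqrt2}{3}\,Q'(\sigma(z))-\sigma'(z)\quad(z\in\mathbb{R}),\qquad \Phi_1(0)=0,$$ is given by $$\Phi_1(z)=\frac43\,\sigma'(z)\int_0^{\sigma(z)}\frac{Q(u)-Q_1(u)}{(1-u^2)^3}\,du .$$
   Context: Here $W''(\phi)=3\phi^2-1$, and $\sigma$ is the heteroclinic profile solving $\sigma''=W'(\sigma)$, $\sigma(\pm\infty)=\pm1$, $\sigma(0)=0$, with $\sigma'=\tfrac{1}{\sqrt2}(1-\sigma^2)$. Primes on $\sigma$ and $\Phi_1$ denote $d/dz$. *)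

theory Defs
  imports "HOL-Analysis.Analysis"
begin

text \<open>Infinite differentiability on a set S, which may be a closed interval:
  \<open>D n\<close> is the n-th derivative, one-sided at the end points of the interval.\<close>

definition smooth_within :: "real set \<Rightarrow> (real \<Rightarrow> real) \<Rightarrow> bool" where
  "smooth_within S f \<longleftrightarrow>
     (\<exists>D :: nat \<Rightarrow> real \<Rightarrow> real.
        (\<forall>x\<in>S. D 0 x = f x) \<and>
        (\<forall>n. \<forall>x\<in>S. (D n has_real_derivative D (Suc n) x) (at x within S)))"

definition W :: "real \<Rightarrow> real" where
  "W \<phi> = 1/4 * (\<phi>^2 - 1)^2"

definition heteroclinic :: "real \<Rightarrow> real" where
  "heteroclinic z = tanh (z / sqrt 2)"

definition Q\<^sub>1 :: "real \<Rightarrow> real" where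
  "Q\<^sub>1 u = 3/2 * (u - u^3/3)"

text \<open>Only the values of Q on [-1,1] are meaningful. As \<open>heteroclinic z\<close> lies in the open
  interval (-1,1), the two-sided derivative \<open>deriv Q (heteroclinic z)\<close> depends only on them.
  The differentiability conditions are needed because \<open>deriv\<close> is total.\<close>

definition solves_corrector_eq :: "(real \<Rightarrow> real) \<Rightarrow> (real \<Rightarrow> real) \<Rightarrow> bool" where
  "solves_corrector_eq Q \<Phi> \<longleftrightarrow>
     (\<forall>z. \<Phi> field_differentiable at z) \<and>
     (\<forall>z. deriv \<Phi> field_differentiable at z) \<and>
     (\<forall>z. deriv (deriv \<Phi>) z - deriv (deriv W) (heteroclinic z) * \<Phi> z
          = sqrt 2 / 3 * deriv Q (heteroclinic z) - deriv heteroclinic z)"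

definition bounded_corrector :: "(real \<Rightarrow> real) \<Rightarrow> (real \<Rightarrow> real) \<Rightarrow> bool" where
  "bounded_corrector Q \<Phi> \<longleftrightarrow>
     bounded (range \<Phi>) \<and> solves_corrector_eq Q \<Phi> \<and> \<Phi> 0 = 0"

lemma deriv_Q\<^sub>1: "deriv Q\<^sub>1 u = 3/2 * (1 - u^2)"
proof -
  have "(Q\<^sub>1 has_real_derivative 3/2 * (1 - u^2)) (at u)"
    unfolding Q\<^sub>1_def[abs_def] by (auto intro!: derivative_eq_intros)
  then show ?thesis by (rule DERIV_imp_deriv)
qed

lemma deriv_W: "deriv W = (\<lambda>\<phi>. \<phi>^3 - \<phi>)"
proof
  fix \<phi> :: real
  have "(W has_real_derivative \<phi>^3 - \<phi>) (at \<phi>)"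
    unfolding W_def[abs_def]
    by (auto intro!: derivative_eq_intros simp: algebra_simps power2_eq_square power3_eq_cube)
  then show "deriv W \<phi> = \<phi>^3 - \<phi>" by (rule DERIV_imp_deriv)
qed

lemma deriv_deriv_W: "deriv (deriv W) \<phi> = 3 * \<phi>^2 - 1"
proof -
  have "((\<lambda>\<phi>. \<phi>^3 - \<phi>) has_real_derivative 3 * \<phi>^2 - 1) (at \<phi>)"
    by (auto intro!: derivative_eq_intros)
  then show ?thesis unfolding deriv_W by (rule DERIV_imp_deriv)
qed

lemma deriv_heteroclinic: "deriv heteroclinic z = 1 / sqrt 2 * (1 - (heteroclinic z)^2)"
proof -
  have "cosh (z / sqrt 2) \<noteq> 0" by simp
  then have "(heteroclinic has_real_derivative 1 / sqrt 2 * (1 - (heteroclinic z)^2)) (at z)"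
    unfolding heteroclinic_def[abs_def]
    by (auto intro!: derivative_eq_intros simp: real_div_sqrt field_simps)
  then show ?thesis by (rule DERIV_imp_deriv)
qed

end

theory Submission
  imports Defs
begin

text \<open>
  Write \<open>\<sigma>\<close> for the heteroclinic profile. Differentiating \<open>\<sigma>'' = W'(\<sigma>)\<close> shows that \<open>\<sigma>'\<close> solves
  the homogeneous equation \<open>\<psi>'' = W''(\<sigma>) \<psi>\<close>; everything follows by comparing other solutions
  with this one, which is positive and tends to \<open>0\<close>.

  Uniqueness: the difference \<open>\<psi>\<close> of two bounded solutions is a bounded solution of the homogeneous
  equation, so its Wronskian \<open>c = \<psi>' \<sigma>' - \<psi> \<sigma>''\<close> with \<open>\<sigma>'\<close> is constant. The mean value theorem
  on \<open>[x, x + 1]\<close>, with \<open>x\<close> large, yields arbitrarily late points at which \<open>\<psi>'\<close> is bounded by a fixed constant; there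
  \<open>\<sigma>'\<close> and \<open>\<sigma>''\<close> are as small as desired, hence \<open>c = 0\<close>. Then \<open>\<psi>\<close> is a constant multiple of \<open>\<sigma>'\<close>,
  and \<open>\<psi>(0) = 0\<close> makes this multiple \<open>0\<close> (lemma \<open>bounded_homogeneous_solution_eq_0\<close>).

  Existence: reduction of order, \<open>\<Phi> = 4/3 \<sigma>' A(\<sigma>)\<close> with \<open>\<sigma>\<close> itself as the independent variable,
  leads to \<open>A'(s) = (Q(s) - Q\<^sub>1(s)) / (1 - s\<^sup>2)\<^sup>3\<close>, because \<open>\<sigma>'\<close> is the polynomial
  \<open>(1 - \<sigma>\<^sup>2) / \<surd>2\<close> in \<open>\<sigma>\<close> (lemma \<open>corrector_formula_solves\<close>).

  Boundedness is the place where the values of \<open>Q\<close> at \<open>\<plusminus>1\<close> enter: \<open>Q - Q\<^sub>1\<close> is Lipschitz on \<open>[-1,1]\<close>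
  and vanishes at both ends, so it is at most \<open>C (1 - s\<^sup>2)\<close>. Therefore \<open>\<bar>A'(s)\<bar> \<le> C / (1 - s\<^sup>2)\<^sup>2\<close>,
  which is dominated by the derivative of \<open>C s / (1 - s\<^sup>2)\<close>, and the factor \<open>\<sigma>'\<close> exactly
  compensates the resulting growth of \<open>A(\<sigma>)\<close> (lemma \<open>corrector_formula_bounded\<close>).
\<close>

section \<open>The profile\<close>

lemma heteroclinic_bounds: "heteroclinic z \<in> {-1<..<1}"
  using tanh_real_bounds[of "z / sqrt 2"] by (simp add: heteroclinic_def)

lemma heteroclinic_0 [simp]: "heteroclinic 0 = 0"
  by (simp add: heteroclinic_def)

lemma one_minus_square_pos: "0 < 1 - s\<^sup>2" if "s \<in> {-1<..<1}" for s :: real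
  using that by (simp add: abs_square_less_1 abs_less_iff)

lemma deriv_heteroclinic_pos: "0 < deriv heteroclinic z"
  using one_minus_square_pos[OF heteroclinic_bounds[of z]] by (simp add: deriv_heteroclinic)

lemma heteroclinic_has_derivative:
  "(heteroclinic has_real_derivative deriv heteroclinic z) (at z)"
proof -
  have "cosh (z / sqrt 2) \<noteq> 0" by simp
  then have "heteroclinic field_differentiable at z"
    unfolding heteroclinic_def[abs_def] field_differentiable_def
    by (auto intro!: exI derivative_eq_intros)
  then show ?thesis
    by (simp add: DERIV_deriv_iff_field_differentiable)
qed

lemma deriv_heteroclinic_has_derivative:
  "(deriv heteroclinic has_real_derivative - sqrt 2 * heteroclinic z * deriv heteroclinic z) (at z)"
proof -
  have "((\<lambda>z. 1 - (heteroclinic z)\<^sup>2) has_real_derivative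
      - (2 * heteroclinic z * deriv heteroclinic z)) (at z)"
    by (auto intro!: derivative_eq_intros heteroclinic_has_derivative)
  then have "((\<lambda>z. 1 / sqrt 2 * (1 - (heteroclinic z)\<^sup>2)) has_real_derivative
      1 / sqrt 2 * (- (2 * heteroclinic z * deriv heteroclinic z))) (at z)"
    by (rule DERIV_cmult)
  moreover have "1 / sqrt 2 * (- (2 * heteroclinic z * deriv heteroclinic z))
      = - sqrt 2 * heteroclinic z * deriv heteroclinic z"
  proof -
    have "1 / q * (- (q * q * a * b)) = - q * a * b" if "q \<noteq> 0" for q a b :: real
      using that by simp
    from this[of "sqrt 2"] show ?thesis
      by (simp del: mult_minus_left mult_minus_right)
  qed
  moreover have "deriv heteroclinic = (\<lambda>z. 1 / sqrt 2 * (1 - (heteroclinic z)\<^sup>2))"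
    by (simp add: fun_eq_iff deriv_heteroclinic)
  ultimately show ?thesis
    by metis
qed

text \<open>The differentiated function is the second derivative of the profile, so \<open>\<sigma>'\<close> solves the
  linearisation of the profile equation.\<close>

lemma deriv_heteroclinic_solves_homogeneous:
  "((\<lambda>z. - sqrt 2 * heteroclinic z * deriv heteroclinic z) has_real_derivative
      deriv (deriv W) (heteroclinic z) * deriv heteroclinic z) (at z)"
proof -
  have sq: "sqrt 2 * deriv heteroclinic z = 1 - (heteroclinic z)\<^sup>2"
    by (simp add: deriv_heteroclinic)
  have "((\<lambda>z. - sqrt 2 * heteroclinic z * deriv heteroclinic z) has_real_derivative
      - sqrt 2 * deriv heteroclinic z * deriv heteroclinic z
      + - sqrt 2 * heteroclinic z * (- sqrt 2 * heteroclinic z * deriv heteroclinic z)) (at z)"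
    by (auto intro!: derivative_eq_intros heteroclinic_has_derivative
        deriv_heteroclinic_has_derivative)
  moreover have "- sqrt 2 * deriv heteroclinic z * deriv heteroclinic z
      + - sqrt 2 * heteroclinic z * (- sqrt 2 * heteroclinic z * deriv heteroclinic z)
      = (2 * (heteroclinic z)\<^sup>2 - sqrt 2 * deriv heteroclinic z) * deriv heteroclinic z"
    by (simp add: algebra_simps power2_eq_square)
  ultimately show ?thesis
    by (simp add: sq deriv_deriv_W)
qed

lemma deriv_heteroclinic_tendsto_0: "(deriv heteroclinic \<longlongrightarrow> 0) at_top"
proof -
  have "filterlim (\<lambda>z. z / sqrt 2) at_top at_top"
    using filterlim_tendsto_pos_mult_at_top[OF tendsto_const[of "1 / sqrt 2"] _ filterlim_ident]
    by simp
  then have "(heteroclinic \<longlongrightarrow> 1) at_top"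
    unfolding heteroclinic_def[abs_def]
    by (rule filterlim_compose[OF tanh_real_at_top])
  then have "((\<lambda>z. 1 / sqrt 2 * (1 - (heteroclinic z)\<^sup>2)) \<longlongrightarrow> 1 / sqrt 2 * (1 - 1\<^sup>2)) at_top"
    by (intro tendsto_intros)
  then show ?thesis
    by (simp add: deriv_heteroclinic[abs_def])
qed

section \<open>Uniqueness of the bounded solution\<close>

lemma bounded_homogeneous_solution_eq_0:
  fixes \<psi> \<psi>' :: "real \<Rightarrow> real"
  assumes bdd: "bounded (range \<psi>)"
    and d1: "\<And>z. (\<psi> has_real_derivative \<psi>' z) (at z)"
    and d2: "\<And>z. (\<psi>' has_real_derivative deriv (deriv W) (heteroclinic z) * \<psi> z) (at z)"
    and zero: "\<psi> 0 = 0"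
  shows "\<psi> z = 0"
proof -
  let ?\<sigma> = heteroclinic and ?p = "deriv heteroclinic"
  define w where "w z = \<psi>' z * ?p z - \<psi> z * (- sqrt 2 * ?\<sigma> z * ?p z)" for z
  have "(w has_real_derivative 0) (at z)" for z
    using DERIV_diff[OF DERIV_mult[OF d2 deriv_heteroclinic_has_derivative]
        DERIV_mult[OF d1 deriv_heteroclinic_solves_homogeneous], of z]
    unfolding w_def[abs_def] by (simp add: algebra_simps)
  then have w_const: "w z = w 0" for z
    using DERIV_isconst_all by blast
  obtain M where M: "\<And>z. \<bar>\<psi> z\<bar> \<le> M"
    using bdd by (auto simp: bounded_iff)
  have M0: "0 \<le> M"
    using M[of 0] by linarith
  have w_small: "\<exists>\<xi>>x. \<bar>w 0\<bar> \<le> (2 * M + M * sqrt 2) * ?p \<xi>" for x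
  proof -
    obtain \<xi> where \<xi>: "x < \<xi>" "\<psi> (x + 1) - \<psi> x = \<psi>' \<xi>"
      using MVT2[of x "x + 1" \<psi> \<psi>'] d1 by auto
    have "\<bar>\<psi>' \<xi>\<bar> \<le> 2 * M"
      using M[of x] M[of "x + 1"] unfolding \<xi>(2)[symmetric] by linarith
    then have 1: "\<bar>\<psi>' \<xi>\<bar> * ?p \<xi> \<le> 2 * M * ?p \<xi>"
      using deriv_heteroclinic_pos[of \<xi>] by (intro mult_right_mono) auto
    have "\<bar>\<psi> \<xi>\<bar> * \<bar>?\<sigma> \<xi>\<bar> \<le> M * 1"
      using M[of \<xi>] M0 heteroclinic_bounds[of \<xi>] by (intro mult_mono) auto
    then have 2: "\<bar>\<psi> \<xi>\<bar> * \<bar>?\<sigma> \<xi>\<bar> * (sqrt 2 * ?p \<xi>) \<le> M * 1 * (sqrt 2 * ?p \<xi>)"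
      using deriv_heteroclinic_pos[of \<xi>] by (intro mult_right_mono) auto
    have "\<bar>w \<xi>\<bar> \<le> \<bar>\<psi>' \<xi> * ?p \<xi>\<bar> + \<bar>\<psi> \<xi> * (- sqrt 2 * ?\<sigma> \<xi> * ?p \<xi>)\<bar>"
      unfolding w_def by (rule abs_triangle_ineq4)
    also have "\<dots> = \<bar>\<psi>' \<xi>\<bar> * ?p \<xi> + \<bar>\<psi> \<xi>\<bar> * \<bar>?\<sigma> \<xi>\<bar> * (sqrt 2 * ?p \<xi>)"
      using deriv_heteroclinic_pos[of \<xi>] by (simp add: abs_mult)
    also have "\<dots> \<le> (2 * M + M * sqrt 2) * ?p \<xi>"
      using 1 2 by (simp add: algebra_simps)
    finally show ?thesis
      using \<xi>(1) w_const[of \<xi>] by auto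
  qed
  have w0: "w 0 = 0"
  proof (rule ccontr)
    assume "w 0 \<noteq> 0"
    have "((\<lambda>z. (2 * M + M * sqrt 2) * ?p z) \<longlongrightarrow> (2 * M + M * sqrt 2) * 0) at_top"
      by (intro tendsto_intros deriv_heteroclinic_tendsto_0)
    then have "\<forall>\<^sub>F z in at_top. (2 * M + M * sqrt 2) * ?p z < \<bar>w 0\<bar>"
      using \<open>w 0 \<noteq> 0\<close> by (intro order_tendstoD(2)) auto
    then obtain x where "\<And>z. z \<ge> x \<Longrightarrow> (2 * M + M * sqrt 2) * ?p z < \<bar>w 0\<bar>"
      by (auto simp: eventually_at_top_linorder)
    then show False
      using w_small[of x] by (meson less_imp_le not_le)
  qed
  \<comment> \<open>The derivative of \<open>\<psi> / \<sigma>'\<close> is the Wronskian divided by the square of \<open>\<sigma>'\<close>.\<close>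
  have "((\<lambda>z. \<psi> z / ?p z) has_real_derivative w z / (?p z * ?p z)) (at z)" for z
    using DERIV_divide[OF d1 deriv_heteroclinic_has_derivative, of z] deriv_heteroclinic_pos[of z]
    by (simp add: w_def)
  then have "\<psi> z / ?p z = \<psi> 0 / ?p 0"
    using w_const w0 DERIV_isconst_all[of "\<lambda>z. \<psi> z / ?p z"] by simp
  then show ?thesis
    using zero deriv_heteroclinic_pos[of z] by simp
qed

lemma bounded_corrector_unique:
  assumes \<Phi>: "bounded_corrector Q \<Phi>" and \<Psi>: "bounded_corrector Q \<Psi>"
  shows "\<Phi> = \<Psi>"
proof
  fix z
  have D: "(f has_real_derivative deriv f z) (at z)"
    "(deriv f has_real_derivative deriv (deriv f) z) (at z)" if "bounded_corrector Q f" for f z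
    using that by (auto simp: bounded_corrector_def solves_corrector_eq_def
        DERIV_deriv_iff_field_differentiable)
  have eq: "deriv (deriv f) z = deriv (deriv W) (heteroclinic z) * f z
      + (sqrt 2 / 3 * deriv Q (heteroclinic z) - deriv heteroclinic z)"
    if "bounded_corrector Q f" for f z
  proof -
    have "deriv (deriv f) z - deriv (deriv W) (heteroclinic z) * f z
        = sqrt 2 / 3 * deriv Q (heteroclinic z) - deriv heteroclinic z"
      using that unfolding bounded_corrector_def solves_corrector_eq_def by blast
    then show ?thesis by linarith
  qed
  have "\<Phi> z - \<Psi> z = 0"
  proof (rule bounded_homogeneous_solution_eq_0[where \<psi> = "\<lambda>z. \<Phi> z - \<Psi> z"])
    show "bounded (range (\<lambda>z. \<Phi> z - \<Psi> z))"
      using \<Phi> \<Psi> by (intro bounded_minus_comp) (auto simp: bounded_corrector_def)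
    show "((\<lambda>z. \<Phi> z - \<Psi> z) has_real_derivative deriv \<Phi> z - deriv \<Psi> z) (at z)" for z
      by (intro DERIV_diff D \<Phi> \<Psi>)
    show "((\<lambda>z. deriv \<Phi> z - deriv \<Psi> z) has_real_derivative
        deriv (deriv W) (heteroclinic z) * (\<Phi> z - \<Psi> z)) (at z)" for z
      using DERIV_diff[OF D(2)[OF \<Phi>] D(2)[OF \<Psi>], of z]
      by (simp add: eq[OF \<Phi>] eq[OF \<Psi>] right_diff_distrib)
    show "\<Phi> 0 - \<Psi> 0 = 0"
      using \<Phi> \<Psi> by (simp add: bounded_corrector_def)
  qed
  then show "\<Phi> z = \<Psi> z" by simp
qed

section \<open>The explicit solution\<close>

lemma interval_integral_has_derivative:
  fixes f :: "real \<Rightarrow> real"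
  assumes cont: "continuous_on {a<..<b} f" and c: "c \<in> {a<..<b}" and s: "s \<in> {a<..<b}"
  shows "((\<lambda>s. LBINT u=c..s. f u) has_real_derivative f s) (at s)"
proof -
  obtain a' where a': "a < a'" "a' < min c s"
    using dense[of a "min c s"] c s by auto
  obtain b' where b': "max c s < b'" "b' < b"
    using dense[of "max c s" b] c s by auto
  have "continuous_on {a'..b'} f"
    using a' b' by (intro continuous_on_subset[OF cont]) auto
  then have "((\<lambda>s. LBINT u=c..s. f u) has_vector_derivative f s) (at s within {a'..b'})"
    using a' b' by (intro interval_integral_FTC2) auto
  moreover have "at s within {a'..b'} = at s"
    using a' b' by (intro at_within_Icc_at) auto
  ultimately show ?thesis
    by (simp add: has_real_derivative_iff_has_vector_derivative)
qed

text \<open>The variable coefficient of \<open>\<sigma>'\<close> in the reduction of order, as a function of the value \<open>s\<close>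
  of the profile instead of the position \<open>z\<close>.\<close>

definition corrector_amplitude :: "(real \<Rightarrow> real) \<Rightarrow> real \<Rightarrow> real" where
  "corrector_amplitude Q s = (LBINT u=0..s. (Q u - Q\<^sub>1 u) / (1 - u^2)^3)"

lemma corrector_amplitude_0: "corrector_amplitude Q 0 = 0"
  by (simp add: corrector_amplitude_def zero_ereal_def)

lemma corrector_amplitude_has_derivative:
  assumes "continuous_on {-1<..<1} Q" and s: "s \<in> {-1<..<1}"
  shows "(corrector_amplitude Q has_real_derivative (Q s - Q\<^sub>1 s) / (1 - s\<^sup>2)^3) (at s)"
proof -
  have "continuous_on {-1<..<1} (\<lambda>u. (Q u - Q\<^sub>1 u) / (1 - u\<^sup>2)^3)"
    unfolding Q\<^sub>1_def using one_minus_square_pos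
    by (intro continuous_intros assms) force+
  from interval_integral_has_derivative[OF this, of 0 s] s show ?thesis
    by (simp add: corrector_amplitude_def[abs_def] zero_ereal_def)
qed

definition corrector_formula :: "(real \<Rightarrow> real) \<Rightarrow> real \<Rightarrow> real" where
  "corrector_formula Q z = 4/3 * deriv heteroclinic z * corrector_amplitude Q (heteroclinic z)"

text \<open>In the first derivative the power of \<open>1 - \<sigma>\<^sup>2\<close> in the integrand is reduced from three to
  one by the two factors \<open>\<sigma>'\<close>. Differentiating once more, the terms with \<open>Q - Q\<^sub>1\<close> cancel and
  only \<open>Q' - Q\<^sub>1'\<close> remains beside \<open>W''(\<sigma>) \<Phi>\<close>; here \<open>\<surd>2 / 3 Q\<^sub>1'(\<sigma>) = \<sigma>'\<close>.\<close>

lemma corrector_formula_solves: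
  assumes Q': "\<And>s. s \<in> {-1<..<1} \<Longrightarrow> (Q has_real_derivative Q' s) (at s)"
  shows "solves_corrector_eq Q (corrector_formula Q)"
proof -
  let ?\<sigma> = heteroclinic and ?p = "deriv heteroclinic"
  let ?A = "corrector_amplitude Q" and ?R = "\<lambda>s. Q s - Q\<^sub>1 s"
  have cont: "continuous_on {-1<..<1} Q"
    by (rule DERIV_continuous_on) (use Q' in \<open>blast intro: has_field_derivative_at_within\<close>)
  have A: "((\<lambda>z. ?A (?\<sigma> z)) has_real_derivative ?R (?\<sigma> z) / (1 - (?\<sigma> z)\<^sup>2)^3 * ?p z) (at z)" for z
    by (rule DERIV_chain2[OF corrector_amplitude_has_derivative[OF cont heteroclinic_bounds]
          heteroclinic_has_derivative])
  define \<Phi>' where "\<Phi>' z = 4/3 * ((- sqrt 2 * ?\<sigma> z * ?p z) * ?A (?\<sigma> z)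
      + ?R (?\<sigma> z) / (2 * (1 - (?\<sigma> z)\<^sup>2)))" for z
  have d1: "(corrector_formula Q has_real_derivative \<Phi>' z) (at z)" for z
  proof -
    have ne: "1 - (?\<sigma> z)\<^sup>2 \<noteq> 0"
      using one_minus_square_pos[OF heteroclinic_bounds[of z]] by simp
    have pp: "?p z * ?p z = (1 - (?\<sigma> z)\<^sup>2)\<^sup>2 / 2"
      by (simp add: deriv_heteroclinic power2_eq_square)
    have "?R (?\<sigma> z) / (1 - (?\<sigma> z)\<^sup>2)^3 * ?p z * ?p z
        = ?R (?\<sigma> z) / (1 - (?\<sigma> z)\<^sup>2)^3 * ((1 - (?\<sigma> z)\<^sup>2)\<^sup>2 / 2)"
      unfolding mult.assoc pp ..
    also have "\<dots> = ?R (?\<sigma> z) / (2 * (1 - (?\<sigma> z)\<^sup>2))"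
      using ne by (simp add: power2_eq_square power3_eq_cube)
    finally have eq: "?R (?\<sigma> z) / (1 - (?\<sigma> z)\<^sup>2)^3 * ?p z * ?p z
        = ?R (?\<sigma> z) / (2 * (1 - (?\<sigma> z)\<^sup>2))" .
    have "((\<lambda>z. 4/3 * (?p z * ?A (?\<sigma> z))) has_real_derivative
        4/3 * ((- sqrt 2 * ?\<sigma> z * ?p z) * ?A (?\<sigma> z)
          + ?R (?\<sigma> z) / (1 - (?\<sigma> z)\<^sup>2)^3 * ?p z * ?p z)) (at z)"
      by (intro DERIV_cmult DERIV_mult deriv_heteroclinic_has_derivative A)
    then show ?thesis
      unfolding eq by (simp add: \<Phi>'_def corrector_formula_def[abs_def] mult.assoc)
  qed
  have d2: "(\<Phi>' has_real_derivative deriv (deriv W) (?\<sigma> z) * corrector_formula Q z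
      + (sqrt 2 / 3 * Q' (?\<sigma> z) - ?p z)) (at z)" for z
  proof -
    define s where "s = ?\<sigma> z"
    have ne: "1 - s\<^sup>2 \<noteq> 0"
      using one_minus_square_pos[OF heteroclinic_bounds[of z]] by (simp add: s_def)
    have p: "?p z = (1 - s\<^sup>2) / sqrt 2"
      by (simp add: deriv_heteroclinic s_def)
    have R: "(?R has_real_derivative Q' s - 3/2 * (1 - s\<^sup>2)) (at s)"
      unfolding Q\<^sub>1_def s_def
      by (auto intro!: derivative_eq_intros Q' heteroclinic_bounds)
    have "((\<lambda>s. ?R s / (2 * (1 - s\<^sup>2))) has_real_derivative
        ((Q' s - 3/2 * (1 - s\<^sup>2)) * (2 * (1 - s\<^sup>2)) - ?R s * (- 4 * s))
          / ((2 * (1 - s\<^sup>2)) * (2 * (1 - s\<^sup>2)))) (at s)"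
      by (rule DERIV_divide[OF R]) (use ne in \<open>auto intro!: derivative_eq_intros\<close>)
    from DERIV_chain2[OF this[unfolded s_def] heteroclinic_has_derivative]
    have h: "((\<lambda>z. ?R (?\<sigma> z) / (2 * (1 - (?\<sigma> z)\<^sup>2))) has_real_derivative
        ((Q' s - 3/2 * (1 - s\<^sup>2)) * (2 * (1 - s\<^sup>2)) - ?R s * (- 4 * s))
          / ((2 * (1 - s\<^sup>2)) * (2 * (1 - s\<^sup>2))) * ?p z) (at z)"
      by (simp add: s_def)
    have reduce: "?R s / (1 - s\<^sup>2)^3 * ?p z * (- sqrt 2 * s * ?p z)
          + ((Q' s - 3/2 * (1 - s\<^sup>2)) * (2 * (1 - s\<^sup>2)) - ?R s * (- 4 * s))
          / ((2 * (1 - s\<^sup>2)) * (2 * (1 - s\<^sup>2))) * ?p z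
        = (Q' s - 3/2 * (1 - s\<^sup>2)) / (2 * sqrt 2)"
    proof -
      have *: "r / m^3 * (m / q) * (- q * s * (m / q))
          + (t * (2 * m) - r * (- 4 * s)) / ((2 * m) * (2 * m)) * (m / q) = t / (2 * q)"
        if "m \<noteq> 0" "q \<noteq> 0" for r m q s t :: real
        using that by (simp add: field_simps power3_eq_cube)
      show ?thesis
        unfolding p using ne by (intro *) auto
    qed
    have source: "4/3 * ((Q' s - 3/2 * (1 - s\<^sup>2)) / (2 * sqrt 2)) = sqrt 2 / 3 * Q' s - ?p z"
    proof -
      have *: "4/3 * ((t - 3/2 * m) / (2 * q)) = q / 3 * t - m / q"
        if "q * q = 2" "q \<noteq> 0" for t m q :: real
        using that by (simp add: field_simps)
      show ?thesis
        unfolding p by (intro *) auto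
    qed
    have "(\<Phi>' has_real_derivative
        4/3 * (deriv (deriv W) (?\<sigma> z) * ?p z * ?A (?\<sigma> z)
            + ?R (?\<sigma> z) / (1 - (?\<sigma> z)\<^sup>2)^3 * ?p z * (- sqrt 2 * ?\<sigma> z * ?p z)
          + ((Q' s - 3/2 * (1 - s\<^sup>2)) * (2 * (1 - s\<^sup>2)) - ?R s * (- 4 * s))
          / ((2 * (1 - s\<^sup>2)) * (2 * (1 - s\<^sup>2))) * ?p z)) (at z)"
      unfolding \<Phi>'_def[abs_def]
      by (intro DERIV_cmult DERIV_add DERIV_mult deriv_heteroclinic_solves_homogeneous A h)
    moreover have "4/3 * (a * ?p z * b + x + y) = a * (4/3 * ?p z * b) + 4/3 * (x + y)"
      for a b x y :: real
      by (simp add: algebra_simps)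
    ultimately show ?thesis
      unfolding s_def[symmetric] corrector_formula_def by (simp only: reduce source)
  qed
  have "deriv (corrector_formula Q) = \<Phi>'"
    using d1 by (auto intro: DERIV_imp_deriv)
  moreover have "deriv \<Phi>' z = deriv (deriv W) (?\<sigma> z) * corrector_formula Q z
      + (sqrt 2 / 3 * Q' (?\<sigma> z) - ?p z)" for z
    using d2 by (rule DERIV_imp_deriv)
  moreover have "deriv Q (?\<sigma> z) = Q' (?\<sigma> z)" for z
    by (rule DERIV_imp_deriv[OF Q'[OF heteroclinic_bounds]])
  ultimately show ?thesis
    unfolding solves_corrector_eq_def field_differentiable_def
    using d1 d2 by (metis add_diff_cancel_left')
qed

section \<open>Boundedness of the explicit solution\<close>

text \<open>The bound on \<open>R'\<close> is a Lipschitz constant. A Lipschitz function vanishing at both ends is bounded by the distance to the nearer end,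
  and of the two factors of \<open>1 - s\<^sup>2 = (1 - s) (1 + s)\<close> the larger one is at least \<open>1\<close>.\<close>

lemma C1_vanishing_at_ends_le:
  fixes R R' :: "real \<Rightarrow> real"
  assumes R': "\<And>s. s \<in> {-1..1} \<Longrightarrow> (R has_real_derivative R' s) (at s within {-1..1})"
    and cont: "continuous_on {-1..1} R'"
    and ends: "R 1 = 0" "R (-1) = 0"
  obtains C where "0 \<le> C" "\<And>s. s \<in> {-1..1} \<Longrightarrow> \<bar>R s\<bar> \<le> C * (1 - s\<^sup>2)"
proof -
  have "bounded (R' ` {-1..1})"
    by (intro compact_imp_bounded compact_continuous_image cont) auto
  then obtain C where C: "\<And>s. s \<in> {-1..1} \<Longrightarrow> \<bar>R' s\<bar> \<le> C"
    unfolding bounded_iff by (metis imageI real_norm_def)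
  have C0: "0 \<le> C"
    using C[of 0] by simp
  have lip: "\<bar>R x - R y\<bar> \<le> C * \<bar>x - y\<bar>" if "x \<in> {-1..1}" "y \<in> {-1..1}" for x y
    using field_differentiable_bound[of "{-1..1}" R R' C x y] R' C that by auto
  have "\<bar>R s\<bar> \<le> C * (1 - s\<^sup>2)" if s: "s \<in> {-1..1}" for s
  proof (cases "s \<ge> 0")
    case True
    have "s * s \<le> s * 1"
      using s True by (intro mult_left_mono) auto
    then have "C * \<bar>s - 1\<bar> \<le> C * (1 - s\<^sup>2)"
      using s C0 by (intro mult_left_mono) (auto simp: power2_eq_square)
    then show ?thesis
      using lip[of s 1] s ends by simp
  next
    case False
    have "0 \<le> (- s) * (1 + s)"
      using s False by (intro mult_nonneg_nonneg) auto
    then have "C * \<bar>s - (-1)\<bar> \<le> C * (1 - s\<^sup>2)"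
      using s C0 by (intro mult_left_mono) (auto simp: power2_eq_square algebra_simps)
    then show ?thesis
      using lip[of s "-1"] s ends by simp
  qed
  with C0 show thesis by (rule that)
qed

text \<open>Both \<open>g - f\<close> and \<open>g + f\<close> are nondecreasing and vanish at \<open>0\<close>. To the left of \<open>0\<close> the
  function \<open>g\<close> is nonpositive, which is why its absolute value appears.\<close>

lemma abs_le_of_abs_deriv_le:
  fixes f g :: "real \<Rightarrow> real"
  assumes I: "is_interval I" "0 \<in> I" "s \<in> I"
    and f: "\<And>x. x \<in> I \<Longrightarrow> (f has_real_derivative f' x) (at x)" and f0: "f 0 = 0"
    and g: "\<And>x. x \<in> I \<Longrightarrow> (g has_real_derivative g' x) (at x)" and g0: "g 0 = 0"
    and le: "\<And>x. x \<in> I \<Longrightarrow> \<bar>f' x\<bar> \<le> g' x"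
  shows "\<bar>f s\<bar> \<le> \<bar>g s\<bar>"
proof -
  have mono: "g x - f x \<le> g y - f y" "g x + f x \<le> g y + f y"
    if xy: "x \<in> I" "y \<in> I" "x \<le> y" for x y
  proof -
    have in_I: "t \<in> I" if "x \<le> t" "t \<le> y" for t
      using mem_is_interval_1_I[OF I(1) xy(1,2)] that by blast
    show "g x - f x \<le> g y - f y"
    proof (rule DERIV_nonneg_imp_nondecreasing[OF xy(3)])
      fix t assume t: "x \<le> t" "t \<le> y"
      then show "\<exists>d. ((\<lambda>t. g t - f t) has_real_derivative d) (at t) \<and> 0 \<le> d"
        using DERIV_diff[OF g f, OF in_I in_I] le[OF in_I[OF t]]
        by (intro exI[of _ "g' t - f' t"]) auto
    qed
    show "g x + f x \<le> g y + f y"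
    proof (rule DERIV_nonneg_imp_nondecreasing[OF xy(3)])
      fix t assume t: "x \<le> t" "t \<le> y"
      then show "\<exists>d. ((\<lambda>t. g t + f t) has_real_derivative d) (at t) \<and> 0 \<le> d"
        using DERIV_add[OF g f, OF in_I in_I] le[OF in_I[OF t]]
        by (intro exI[of _ "g' t + f' t"]) auto
    qed
  qed
  show ?thesis
  proof (cases "s \<ge> 0")
    case True
    then show ?thesis using mono[OF I(2,3)] f0 g0 by auto
  next
    case False
    then show ?thesis using mono[OF I(3,2)] f0 g0 by auto
  qed
qed

text \<open>The comparison function \<open>s / (1 - s\<^sup>2)\<close> has derivative \<open>(1 + s\<^sup>2) / (1 - s\<^sup>2)\<^sup>2\<close>; bounding
  \<open>1 / (1 - s\<^sup>2)\<^sup>2\<close> by this avoids the logarithm in its own antiderivative and treats both ends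
  at once.\<close>

lemma corrector_formula_bounded:
  assumes cont: "continuous_on {-1<..<1} Q"
    and C0: "0 \<le> C"
    and C: "\<And>s. s \<in> {-1<..<1} \<Longrightarrow> \<bar>Q s - Q\<^sub>1 s\<bar> \<le> C * (1 - s\<^sup>2)"
  shows "bounded (range (corrector_formula Q))"
proof -
  have amp: "(1 - s\<^sup>2) * \<bar>corrector_amplitude Q s\<bar> \<le> C" if s: "s \<in> {-1<..<1}" for s
  proof -
    have "\<bar>corrector_amplitude Q s\<bar> \<le> \<bar>C * (s / (1 - s\<^sup>2))\<bar>"
    proof (rule abs_le_of_abs_deriv_le[where I = "{-1<..<1}"
          and f = "corrector_amplitude Q" and g = "\<lambda>x. C * (x / (1 - x\<^sup>2))"
          and f' = "\<lambda>x. (Q x - Q\<^sub>1 x) / (1 - x\<^sup>2)^3"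
          and g' = "\<lambda>x. C * ((1 + x\<^sup>2) / (1 - x\<^sup>2)\<^sup>2)"])
      fix x :: real assume x: "x \<in> {-1<..<1}"
      note pos = one_minus_square_pos[OF x]
      show "(corrector_amplitude Q has_real_derivative (Q x - Q\<^sub>1 x) / (1 - x\<^sup>2)^3) (at x)"
        by (rule corrector_amplitude_has_derivative[OF cont x])
      have "((\<lambda>x. x / (1 - x\<^sup>2)) has_real_derivative (1 + x\<^sup>2) / (1 - x\<^sup>2)\<^sup>2) (at x)"
        using pos by (auto intro!: derivative_eq_intros simp: power2_eq_square field_simps)
      then show "((\<lambda>x. C * (x / (1 - x\<^sup>2))) has_real_derivative
          C * ((1 + x\<^sup>2) / (1 - x\<^sup>2)\<^sup>2)) (at x)"
        by (rule DERIV_cmult)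
      have "\<bar>(Q x - Q\<^sub>1 x) / (1 - x\<^sup>2)^3\<bar> \<le> C * (1 - x\<^sup>2) / (1 - x\<^sup>2)^3"
        using C[OF x] pos by (simp add: abs_divide divide_right_mono)
      also have "\<dots> = C * (1 / (1 - x\<^sup>2)\<^sup>2)"
        using pos by (simp add: power2_eq_square power3_eq_cube)
      also have "\<dots> \<le> C * ((1 + x\<^sup>2) / (1 - x\<^sup>2)\<^sup>2)"
        using C0 by (intro mult_left_mono divide_right_mono) auto
      finally show "\<bar>(Q x - Q\<^sub>1 x) / (1 - x\<^sup>2)^3\<bar> \<le> C * ((1 + x\<^sup>2) / (1 - x\<^sup>2)\<^sup>2)" .
    qed (use s in \<open>auto simp: corrector_amplitude_0 is_interval_oo\<close>)
    then have "(1 - s\<^sup>2) * \<bar>corrector_amplitude Q s\<bar> \<le> (1 - s\<^sup>2) * \<bar>C * (s / (1 - s\<^sup>2))\<bar>"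
      using one_minus_square_pos[OF s] by (intro mult_left_mono) auto
    also have "\<dots> = C * \<bar>s\<bar>"
      using one_minus_square_pos[OF s] C0 by (simp add: abs_mult abs_divide)
    also have "\<dots> \<le> C"
      using s C0 by (intro mult_left_le) auto
    finally show ?thesis .
  qed
  have "\<bar>corrector_formula Q z\<bar> \<le> 4 / (3 * sqrt 2) * C" for z
  proof -
    let ?s = "heteroclinic z"
    have "\<bar>corrector_formula Q z\<bar>
        = 4 / (3 * sqrt 2) * ((1 - ?s\<^sup>2) * \<bar>corrector_amplitude Q ?s\<bar>)"
      using one_minus_square_pos[OF heteroclinic_bounds[of z]]
      by (simp add: corrector_formula_def deriv_heteroclinic abs_mult abs_divide)
    also have "\<dots> \<le> 4 / (3 * sqrt 2) * C"
      by (intro mult_left_mono amp heteroclinic_bounds) simp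
    finally show ?thesis .
  qed
  then show ?thesis
    by (auto simp: bounded_iff)
qed

section \<open>The corrector\<close>

theorem theorem3:
  fixes Q :: "real \<Rightarrow> real"
  assumes Q_maps: "Q ` {-1..1} \<subseteq> {-1..1}"
    and Q_smooth: "smooth_within {-1..1} Q"
    and Q_odd: "\<And>u. u \<in> {-1..1} \<Longrightarrow> Q (- u) = - Q u"
    and Q_strict_mono: "strict_mono_on {-1..1} Q"
    and Q_right: "Q 1 = 1"
    and Q_left: "Q (-1) = -1"
  shows "(\<exists>!\<Phi>\<^sub>1. bounded_corrector Q \<Phi>\<^sub>1) \<and>
         (\<forall>\<Phi>\<^sub>1. bounded_corrector Q \<Phi>\<^sub>1 \<longrightarrow>
            (\<forall>z. \<Phi>\<^sub>1 z = 4/3 * deriv heteroclinic z *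
               (LBINT u=0..heteroclinic z. (Q u - Q\<^sub>1 u) / (1 - u^2)^3)))"
proof -
  obtain D where D0: "\<And>x. x \<in> {-1..1} \<Longrightarrow> D 0 x = Q x"
    and D: "\<And>n x. x \<in> {-1..1} \<Longrightarrow> (D n has_real_derivative D (Suc n) x) (at x within {-1..1})"
    using Q_smooth unfolding smooth_within_def by blast
  have Q': "(Q has_real_derivative D 1 x) (at x within {-1..1})" if "x \<in> {-1..1}" for x
    using has_field_derivative_transform_within[OF D[OF that, of 0], of 1 Q] D0 that by simp
  have Q'_interior: "(Q has_real_derivative D 1 x) (at x)" if "x \<in> {-1<..<1}" for x
    using Q'[of x] that by (simp add: at_within_Icc_at)
  have cont_Q': "continuous_on {-1..1} (D 1)"
    using D by (rule DERIV_continuous_on)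
  have cont_Q: "continuous_on {-1<..<1} Q"
    by (rule DERIV_continuous_on) (use Q'_interior in \<open>blast intro: has_field_derivative_at_within\<close>)
  obtain C where "0 \<le> C" "\<And>s. s \<in> {-1..1} \<Longrightarrow> \<bar>Q s - Q\<^sub>1 s\<bar> \<le> C * (1 - s\<^sup>2)"
  proof (rule C1_vanishing_at_ends_le[of "\<lambda>s. Q s - Q\<^sub>1 s" "\<lambda>s. D 1 s - 3/2 * (1 - s\<^sup>2)"])
    show "((\<lambda>s. Q s - Q\<^sub>1 s) has_real_derivative D 1 s - 3/2 * (1 - s\<^sup>2)) (at s within {-1..1})"
      if "s \<in> {-1..1}" for s
      unfolding Q\<^sub>1_def using that by (auto intro!: derivative_eq_intros Q')
    show "continuous_on {-1..1} (\<lambda>s. D 1 s - 3/2 * (1 - s\<^sup>2))"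
      by (intro continuous_intros cont_Q')
  qed (auto simp: Q_right Q_left Q\<^sub>1_def)
  then have "bounded (range (corrector_formula Q))"
    by (intro corrector_formula_bounded[OF cont_Q]) auto
  moreover have "corrector_formula Q 0 = 0"
    by (simp add: corrector_formula_def corrector_amplitude_0)
  ultimately have formula: "bounded_corrector Q (corrector_formula Q)"
    using corrector_formula_solves[OF Q'_interior] by (simp add: bounded_corrector_def)
  have "\<Phi> = corrector_formula Q" if "bounded_corrector Q \<Phi>" for \<Phi>
    using bounded_corrector_unique[OF that formula] .
  with formula show ?thesis
    unfolding corrector_formula_def[abs_def] corrector_amplitude_def by blast
qed

end
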